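(* Let $d\ge 1$ be an integer, let $\alpha>d$, and let $(W_x)_{x\in\mathbb{Z}^d}$ be i.i.d. non-negative random variables, distributed as $W$. Assume that there exist $\tau>1$ and $c>0$ such that $$\mathbb{P}(W>x)\ge c\,x^{-(\tau-1)}\quad\text{for all } x\ge 1,$$ and that $\gamma:=\alpha(\tau-1)/d<2$. Then, for the random graph with edge probabilities $p_{xy}=1-\exp\{-\lambda W_xW_y/|x-y|^{\alpha}\}$, $\theta(\lambda)>0$ for every $\lambda>0$, that is, $\lambda_c=0$.
   Context: For $\lambda>0$, the random graph has vertex set $\mathbb{Z}^d$; conditionally on the weights $(W_x)_{x\in\mathbb{Z}^d}$, the edges between distinct vertices $x,y$ are independently present (occupied) with probability $p_{xy}=1-\exp\{-\lambda W_xW_y/|x-y|^{\alpha}\}$, where $|\cdot|$ is the Euclidean norm. The component $\mathcal{C}(0)$ is the set of vertices connected to $0$ by a path of occupied edges. The percolation probability is $\theta(\lambda)=\mathbb{P}(|\mathcal{C}(0)|=\infty)$, and the critical percolation value is $\lambda_c=\inf\{\lambda>0:\theta(\lambda)>0\}$; here $\alpha$ and the weight distribution are fixed. Standing normalization: if the weights have finite mean, they are normalized so that $\mathbb{E}[W]=1$ (this amounts only to rescaling $\lambda$). *)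

theory Defs
  imports "HOL-Probability.Probability" "HOL-Library.Extended_Real"
begin

text \<open>
  The lattice of dimension \<open>d \<ge> 1\<close> is the type \<open>int ^ 'd\<close> with \<open>d = CARD('d)\<close>.
\<close>

definition lattice_dist :: "int ^ 'd::finite \<Rightarrow> int ^ 'd \<Rightarrow> real" where
  "lattice_dist x y = norm ((\<chi> i. real_of_int (x $ i - y $ i)) :: real ^ 'd)"

definition edge_prob ::
  "real \<Rightarrow> real \<Rightarrow> (int ^ 'd::finite \<Rightarrow> real) \<Rightarrow> int ^ 'd \<Rightarrow> int ^ 'd \<Rightarrow> real" where
  "edge_prob \<alpha> lam w x y = 1 - exp (- (lam * w x * w y / lattice_dist x y powr \<alpha>))"

text \<open>
  A realization, on an arbitrary probability space \<open>M\<close>, of the random graph with weight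
  distribution \<open>\<mu>\<close> and parameters \<open>\<alpha>\<close>, \<open>lam\<close>. The set of occupied edges is the symmetric
  irreflexive relation \<open>E \<omega>\<close>, so \<open>(x, y)\<close> and \<open>(y, x)\<close> stand for the same edge.
\<close>

locale scale_free_percolation = prob_space M
  for M :: "'w measure" +
  fixes \<mu> :: "real measure"
    and \<alpha> lam :: real
    and W :: "int ^ 'd::finite \<Rightarrow> 'w \<Rightarrow> real"
    and E :: "'w \<Rightarrow> ((int ^ 'd) \<times> (int ^ 'd)) set"
  assumes weights_indep: "indep_vars (\<lambda>_. borel) W UNIV"
    and weights_distr: "\<And>x. distr M borel (W x) = \<mu>"
    and sym_edges: "\<And>\<omega>. \<omega> \<in> space M \<Longrightarrow> sym (E \<omega>)"
    and irrefl_edges: "\<And>\<omega>. \<omega> \<in> space M \<Longrightarrow> irrefl (E \<omega>)"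
    and edges_measurable: "\<And>x y. {\<omega> \<in> space M. (x, y) \<in> E \<omega>} \<in> sets M"
    \<comment> \<open>Conditional independence of the edge events given all weights, in the product form
      over finite sets of events (as for \<open>indep_events\<close>). The set \<open>J\<close> contains each edge
      in at most one orientation.\<close>
    and edges_cond_indep:
      "\<And>J. \<lbrakk>finite J; \<And>x y. (x, y) \<in> J \<Longrightarrow> x \<noteq> y \<and> (y, x) \<notin> J\<rbrakk> \<Longrightarrow>
        AE \<omega> in M.
          real_cond_exp M
            (vimage_algebra (space M) (\<lambda>\<omega> x. W x \<omega>) (\<Pi>\<^sub>M x\<in>UNIV. borel))
            (indicator {\<omega> \<in> space M. J \<subseteq> E \<omega>}) \<omega>
          = (\<Prod>(x, y)\<in>J. edge_prob \<alpha> lam (\<lambda>z. W z \<omega>) x y)"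

definition component :: "('v \<times> 'v) set \<Rightarrow> 'v \<Rightarrow> 'v set" where
  "component G x = {y. (x, y) \<in> G\<^sup>*}"

definition percolation_prob ::
  "'w measure \<Rightarrow> ('w \<Rightarrow> ((int ^ 'd::finite) \<times> (int ^ 'd)) set) \<Rightarrow> real" where
  "percolation_prob M E = measure M {\<omega> \<in> space M. infinite (component (E \<omega>) 0)}"

text \<open>Taken in the extended reals, so that the infimum of the empty set is \<open>\<infinity>\<close>.\<close>

definition critical_value :: "(real \<Rightarrow> real) \<Rightarrow> ereal" where
  "critical_value \<theta> = Inf (ereal ` {lam. 0 < lam \<and> 0 < \<theta> lam})"

end

theory Submission
  imports Defs "HOL-Real_Asymp.Real_Asymp"
begin

text \<open>
  Call a vertex \<open>x\<close> at distance of order \<open>n\<close> from the origin heavy if \<open>W x > n powr \<beta>\<close>. Since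
  \<open>\<alpha> (\<tau> - 1) < 2 d\<close>, the exponent \<open>\<beta>\<close> can be chosen strictly between \<open>\<alpha> / 2\<close> and \<open>d / (\<tau> - 1)\<close>,
  and the two bounds pull in opposite directions. A cube of \<open>n ^ d\<close> vertices at distance of
  order \<open>n\<close> has on average at least \<open>c n powr (d - \<beta> (\<tau> - 1))\<close> heavy vertices, hence none at all
  only with stretched-exponentially small probability (\<open>prob_heavy_light\<close>). Two
  heavy vertices at scale \<open>n\<close> have weight product at least \<open>n powr (2 \<beta>)\<close>, which beats the
  \<open>\<alpha>\<close>-th power of their distance, so the edge between them is missing only with conditional
  probability at most \<open>exp (- K n powr (2 \<beta> - \<alpha>))\<close>. This beats the polynomial number of pairs, so
  one may ask that all pairs of heavy vertices in consecutive cubes be joined, and no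
  particular heavy vertex has to be selected in each cube.

  The origin is made the root of this chain by requiring that \<open>W 0\<close> be heavy at an initial scale
  \<open>m\<close>. This event has positive probability, and each of the failures just described is unlikely
  given it, because the weights are independent and because the bound on missing edges
  holds conditionally on all weights. The failure probabilities are summable, so for large
  \<open>m\<close> a union bound leaves a set of positive probability on which heavy vertices of all
  scales are connected to the origin (\<open>percolation_through_layers\<close>). The parameter \<open>lam\<close> enters
  only through the constant \<open>K\<close>, so this works for every \<open>lam > 0\<close>.
\<close>

section \<open>Infinite components from layered graphs\<close>

text \<open>
  By induction on \<open>k\<close>, all of \<open>H k\<close> is reachable from the root. The layers may overlap: the
  component is infinite because no vertex lies in infinitely many of them.
\<close>

lemma infinite_component_of_layers:
  assumes root: "H 0 = {r}"
    and nonempty: "\<And>k. H k \<noteq> {}"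
    and linked: "\<And>k x y. x \<in> H k \<Longrightarrow> y \<in> H (Suc k) \<Longrightarrow> x \<noteq> y \<Longrightarrow> (x, y) \<in> G"
    and escape: "\<And>x. finite {k. x \<in> H k}"
  shows "infinite (component G r)"
proof
  assume fin: "finite (component G r)"
  have reach: "\<forall>x\<in>H k. (r, x) \<in> G\<^sup>*" for k
  proof (induction k)
    case 0
    then show ?case by (simp add: root)
  next
    case (Suc k)
    obtain z where z: "z \<in> H k" using nonempty[of k] by blast
    then have "(r, z) \<in> G\<^sup>*" using Suc by blast
    then show ?case using linked[OF z] by (metis rtrancl.rtrancl_into_rtrancl)
  qed
  have "\<exists>x\<in>component G r. x \<in> H k" for k
    using reach[of k] nonempty[of k] by (auto simp: component_def)
  then have "(\<Union>x\<in>component G r. {k. x \<in> H k}) = UNIV" by blast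
  moreover have "finite (\<Union>x\<in>component G r. {k. x \<in> H k})" using fin escape by blast
  ultimately show False by simp
qed

section \<open>Measurability\<close>

context scale_free_percolation
begin

lemma weight_measurable [measurable]: "W x \<in> borel_measurable M"
  using weights_indep by (simp add: indep_vars_def)

lemma edge_measurable [measurable]: "Measurable.pred M (\<lambda>\<omega>. (x, y) \<in> E \<omega>)"
  using edges_measurable by (simp add: pred_def)

lemma relpow_measurable: "Measurable.pred M (\<lambda>\<omega>. (x, y) \<in> E \<omega> ^^ n)"
proof (induction n arbitrary: y)
  case (Suc n)
  note [measurable] = Suc
  have "(\<lambda>\<omega>. (x, y) \<in> E \<omega> ^^ Suc n) = (\<lambda>\<omega>. \<exists>z. (x, z) \<in> E \<omega> ^^ n \<and> (z, y) \<in> E \<omega>)"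
    by auto
  then show ?case by simp
qed simp

text \<open>
  Reachability is a countable union over path lengths of countable unions over intermediate
  vertices. A subset of a countable type is infinite if and only if the codes of its elements
  are unbounded, which turns infinitude into a countable condition.
\<close>

lemma infinite_component_measurable:
  "{\<omega> \<in> space M. infinite (component (E \<omega>) 0)} \<in> sets M"
proof -
  note [measurable] = relpow_measurable
  have "infinite S \<longleftrightarrow> (\<forall>m. \<exists>y. m < to_nat y \<and> y \<in> S)" for S :: "(int ^ 'd) set"
  proof -
    have "infinite S \<longleftrightarrow> infinite (to_nat ` S)"
      using finite_image_iff[of "to_nat" S] inj_on_subset[OF inj_to_nat] by blast
    then show ?thesis unfolding infinite_nat_iff_unbounded by blast
  qed
  then have "{\<omega> \<in> space M. infinite (component (E \<omega>) 0)}
      = {\<omega> \<in> space M. \<forall>m. \<exists>y. m < to_nat y \<and> (\<exists>n. (0, y) \<in> E \<omega> ^^ n)}"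
    by (simp add: component_def rtrancl_power)
  then show ?thesis by simp
qed

section \<open>Probabilities of light sets and of missing edges\<close>

lemma prob_weight: "A \<in> sets borel \<Longrightarrow> prob {\<omega> \<in> space M. W x \<omega> \<in> A} = measure \<mu> A"
  using measure_distr[OF weight_measurable[of x], of A] weights_distr[of x]
  by (simp add: vimage_def Int_def conj_commute)

lemma measure_weight_atMost: "measure \<mu> {..t} = 1 - measure \<mu> {t<..}"
proof -
  have "prob {\<omega> \<in> space M. \<not> t < W 0 \<omega>} = 1 - prob {\<omega> \<in> space M. t < W 0 \<omega>}"
    by (rule prob_neg) simp
  then show ?thesis
    using prob_weight[of "{..t}" 0] prob_weight[of "{t<..}" 0] by (simp add: not_less)
qed

lemma prob_heavy_light:
  assumes "finite V" "z \<notin> V"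
  shows "prob {\<omega> \<in> space M. s < W z \<omega> \<and> (\<forall>x\<in>V. W x \<omega> \<le> t)}
    = prob {\<omega> \<in> space M. s < W z \<omega>} * measure \<mu> {..t} ^ card V"
proof -
  define A where "A x = (if x = z then {s<..} else {..t})" for x
  have "prob (\<Inter>x\<in>insert z V. W x -` A x \<inter> space M)
      = (\<Prod>x\<in>insert z V. prob (W x -` A x \<inter> space M))"
    by (rule indep_varsD[OF weights_indep]) (use assms in \<open>auto simp: A_def\<close>)
  also have "\<dots> = (\<Prod>x\<in>insert z V. measure \<mu> (A x))"
  proof (rule prod.cong[OF refl])
    fix x
    have "W x -` A x \<inter> space M = {\<omega> \<in> space M. W x \<omega> \<in> A x}" by auto
    then show "prob (W x -` A x \<inter> space M) = measure \<mu> (A x)"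
      using prob_weight[of "A x" x] by (simp add: A_def)
  qed
  also have "\<dots> = measure \<mu> {s<..} * (\<Prod>x\<in>V. measure \<mu> (A x))"
    using assms by (simp add: A_def)
  also have "(\<Prod>x\<in>V. measure \<mu> (A x)) = (\<Prod>x\<in>V. measure \<mu> {..t})"
    using assms by (intro prod.cong) (auto simp: A_def)
  also have "measure \<mu> {s<..} = prob {\<omega> \<in> space M. s < W z \<omega>}"
    using prob_weight[of "{s<..}" z] by simp
  also have "(\<Inter>x\<in>insert z V. W x -` A x \<inter> space M)
      = {\<omega> \<in> space M. s < W z \<omega> \<and> (\<forall>x\<in>V. W x \<omega> \<le> t)}"
    using assms by (auto simp: A_def split: if_splits)
  finally show ?thesis by (simp only: prod_constant)
qed

text \<open>The \<open>\<sigma>\<close>-algebra generated by the weights, on which the edge probabilities are conditioned.\<close>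

abbreviation weight_algebra :: "'w measure" where
  "weight_algebra \<equiv> vimage_algebra (space M) (\<lambda>\<omega> x. W x \<omega>) (\<Pi>\<^sub>M x\<in>UNIV. borel)"

lemma weights_measurable: "(\<lambda>\<omega> x. W x \<omega>) \<in> measurable M (\<Pi>\<^sub>M x\<in>UNIV. borel)"
  by (rule measurable_PiM_single') auto

lemma subalgebra_weight_algebra: "subalgebra M weight_algebra"
  using weights_measurable by (auto simp: subalgebra_def sets_vimage_algebra2 measurable_def)

lemma weight_measurable_weight_algebra [measurable]: "W x \<in> borel_measurable weight_algebra"
proof -
  have "(\<lambda>f. f x) \<circ> (\<lambda>\<omega> x. W x \<omega>) \<in> borel_measurable weight_algebra"
    by (rule measurable_comp[OF measurable_vimage_algebra1])
      (auto simp: space_PiM)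
  then show ?thesis by (simp add: comp_def)
qed

text \<open>
  Integrating the conditional probability of the edge over \<open>A\<close> gives the joint probability.
  The event \<open>A\<close> may be any condition on the weights; on it, the missing edge costs a factor \<open>e\<close>.
\<close>

lemma prob_missing_edge_le:
  assumes A: "A \<in> sets weight_algebra" and "x \<noteq> y"
    and le: "\<And>\<omega>. \<omega> \<in> A \<Longrightarrow> 1 - e \<le> edge_prob \<alpha> lam (\<lambda>z. W z \<omega>) x y"
  shows "prob {\<omega> \<in> A. (x, y) \<notin> E \<omega>} \<le> e * prob A"
proof -
  interpret finite_measure_subalgebra M weight_algebra
    by unfold_locales (rule subalgebra_weight_algebra)
  define B where "B = {\<omega> \<in> space M. {(x, y)} \<subseteq> E \<omega>}"
  have B [measurable]: "B \<in> sets M" by (simp add: B_def)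
  have AM [measurable]: "A \<in> sets M"
    using A subalgebra_weight_algebra by (auto simp: subalgebra_def)
  let ?c = "real_cond_exp M weight_algebra (indicator B)"
  have int: "integrable M (indicator B :: 'w \<Rightarrow> real)" by (simp add: emeasure_eq_measure)
  have "AE \<omega> in M. ?c \<omega> = edge_prob \<alpha> lam (\<lambda>z. W z \<omega>) x y"
    using edges_cond_indep[of "{(x, y)}"] \<open>x \<noteq> y\<close> unfolding B_def by simp
  then have ae: "AE \<omega> in M. indicator A \<omega> *\<^sub>R (1 - e) \<le> indicator A \<omega> *\<^sub>R ?c \<omega>"
    by eventually_elim (auto simp: indicator_def le)
  have "(1 - e) * prob A = (\<integral>\<omega>\<in>A. (1 - e) \<partial>M)"
    by (simp add: set_lebesgue_integral_def)
  also have "\<dots> \<le> (\<integral>\<omega>\<in>A. ?c \<omega> \<partial>M)"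
    unfolding set_lebesgue_integral_def
    by (rule integral_mono_AE[OF _ integrable_mult_indicator[OF AM real_cond_exp_int(1)[OF int]] ae])
      (simp add: emeasure_eq_measure)
  also have "\<dots> = (\<integral>\<omega>\<in>A. indicator B \<omega> \<partial>M)"
    by (rule real_cond_exp_intA[OF int A, symmetric])
  also have "\<dots> = prob (A \<inter> B)"
    by (simp add: set_lebesgue_integral_def indicator_inter_arith[symmetric])
  finally have "(1 - e) * prob A \<le> prob (A \<inter> B)" .
  moreover have "{\<omega> \<in> A. (x, y) \<notin> E \<omega>} = A - A \<inter> B"
    using sets.sets_into_space[OF AM] by (auto simp: B_def)
  ultimately show ?thesis
    by (simp add: finite_measure_Diff algebra_simps)
qed

section \<open>Percolation through layers of heavy vertices\<close>

text \<open>
  A union bound on the event that the root is heavy, relative to the probability \<open>p0\<close> of that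
  event. At step \<open>k\<close> two things can go wrong: layer \<open>Suc k\<close> has no heavy vertex, or some edge
  between heavy vertices of layers \<open>k\<close> and \<open>Suc k\<close> is missing. If the relative costs add up to less
  than one, then with positive probability neither ever happens, and the heavy vertices
  form layers as in \<open>infinite_component_of_layers\<close>.
\<close>

lemma percolation_through_layers:
  fixes V :: "nat \<Rightarrow> (int ^ 'd) set" and h r e :: "nat \<Rightarrow> real"
  defines "p0 \<equiv> prob {\<omega> \<in> space M. h 0 < W 0 \<omega>}"
  assumes fin: "\<And>k. finite (V k)" and root: "V 0 = {0}"
    and escape: "\<And>x. finite {k. x \<in> V k}"
    and p0: "0 < p0"
    and light: "\<And>k. prob {\<omega> \<in> space M. h 0 < W 0 \<omega> \<and> (\<forall>x\<in>V (Suc k). W x \<omega> \<le> h (Suc k))}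
      \<le> r k * p0"
    and link: "\<And>k x y w. x \<in> V k \<Longrightarrow> y \<in> V (Suc k) \<Longrightarrow> x \<noteq> y \<Longrightarrow> h k < w x \<Longrightarrow> h (Suc k) < w y
      \<Longrightarrow> 1 - e k \<le> edge_prob \<alpha> lam w x y"
    and e: "\<And>k. 0 \<le> e k"
    and summable: "summable (\<lambda>k. r k + real (card (V k) * card (V (Suc k))) * e k)"
    and small: "(\<Sum>k. r k + real (card (V k) * card (V (Suc k))) * e k) < 1"
  shows "0 < percolation_prob M E"
proof -
  define s where "s k = r k + real (card (V k) * card (V (Suc k))) * e k" for k
  define A0 where "A0 = {\<omega> \<in> space M. h 0 < W 0 \<omega>}"
  \<comment> \<open>The two kinds of failure at step \<open>k\<close>: a light layer \<open>L k\<close>, and missing edges \<open>U k x y\<close>.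
    In the latter, the weight condition \<open>H k x y\<close> is separated out since it depends on the
    weights alone.\<close>
  define L where "L k = {\<omega> \<in> space M. h 0 < W 0 \<omega> \<and> (\<forall>x\<in>V (Suc k). W x \<omega> \<le> h (Suc k))}" for k
  define P where "P k = {(x, y) \<in> V k \<times> V (Suc k). x \<noteq> y}" for k
  define H where "H k x y = {\<omega> \<in> space M. h 0 < W 0 \<omega> \<and> h k < W x \<omega> \<and> h (Suc k) < W y \<omega>}"
    for k x y
  define U where "U k x y = {\<omega> \<in> H k x y. (x, y) \<notin> E \<omega>}" for k x y
  define Bad where "Bad k = L k \<union> (\<Union>(x, y)\<in>P k. U k x y)" for k
  have A0M [measurable]: "A0 \<in> sets M" by (simp add: A0_def)
  have LM: "L k \<in> sets M" for k
    unfolding L_def Ball_def by measurable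
  have UM: "U k x y \<in> sets M" for k x y
    unfolding U_def H_def by simp
  have Pfin: "finite (P k)" for k
    unfolding P_def by (rule finite_subset[of _ "V k \<times> V (Suc k)"]) (auto simp: fin)
  have Pcard: "card (P k) \<le> card (V k) * card (V (Suc k))" for k
    unfolding card_cartesian_product[symmetric] P_def by (rule card_mono) (auto simp: fin)
  have Uprob: "prob (U k x y) \<le> e k * p0" if "(x, y) \<in> P k" for k x y
  proof -
    have "prob (U k x y) \<le> e k * prob (H k x y)"
      unfolding U_def
    proof (rule prob_missing_edge_le)
      have "H k x y = {\<omega> \<in> space weight_algebra. h 0 < W 0 \<omega> \<and> h k < W x \<omega> \<and> h (Suc k) < W y \<omega>}"
        by (simp add: H_def)
      also have "\<dots> \<in> sets weight_algebra" by measurable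
      finally show "H k x y \<in> sets weight_algebra" .
    qed (use that link in \<open>auto simp: P_def H_def\<close>)
    also have "prob (H k x y) \<le> p0"
      unfolding p0_def H_def by (rule finite_measure_mono) auto
    finally show ?thesis by (simp add: e mult_left_mono)
  qed
  have BadM: "Bad k \<in> sets M" for k
    unfolding Bad_def using LM UM Pfin
    by (intro sets.Un sets.finite_UN) (auto simp: case_prod_unfold)
  have Bad: "prob (Bad k) \<le> s k * p0" for k
  proof -
    have "prob (\<Union>(x, y)\<in>P k. U k x y) \<le> (\<Sum>(x, y)\<in>P k. prob (U k x y))"
      using finite_measure_subadditive_finite[OF Pfin, of "\<lambda>(x, y). U k x y" k] UM
      by (auto simp: case_prod_unfold)
    also have "\<dots> \<le> (\<Sum>_\<in>P k. e k * p0)"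
      by (rule sum_mono) (auto intro: Uprob)
    also have "\<dots> \<le> real (card (V k) * card (V (Suc k))) * (e k * p0)"
      unfolding sum_constant using Pcard[of k] e[of k] p0
      by (intro mult_right_mono) (auto simp del: of_nat_mult)
    finally have "prob (\<Union>(x, y)\<in>P k. U k x y)
      \<le> real (card (V k) * card (V (Suc k))) * (e k * p0)" .
    moreover have "prob (L k) \<le> r k * p0" using light[of k] by (simp add: L_def)
    moreover have "prob (Bad k) \<le> prob (L k) + prob (\<Union>(x, y)\<in>P k. U k x y)"
      unfolding Bad_def using LM UM Pfin by (intro measure_Un_le) auto
    ultimately show ?thesis by (simp add: s_def algebra_simps)
  qed
  have sm: "summable s" using summable by (simp add: s_def[abs_def])
  then have smp: "summable (\<lambda>k. s k * p0)" by (rule summable_mult2)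
  have smB: "summable (\<lambda>k. prob (Bad k))"
    by (rule summable_comparison_test'[OF smp]) (simp add: Bad)
  have "prob (\<Union>k. Bad k) \<le> (\<Sum>k. prob (Bad k))"
    by (rule finite_measure_subadditive_countably) (use BadM smB in auto)
  also have "\<dots> \<le> (\<Sum>k. s k * p0)" by (rule suminf_le[OF Bad smB smp])
  also have "\<dots> = (\<Sum>k. s k) * p0" by (rule suminf_mult2[OF sm, symmetric])
  also have "\<dots> < p0" using small p0 by (simp add: s_def[abs_def])
  finally have "0 < prob A0 - prob (\<Union>k. Bad k)" by (simp add: p0_def A0_def)
  also have "\<dots> \<le> prob (A0 - (\<Union>k. Bad k))"
  proof -
    have BM: "(\<Union>k. Bad k) \<in> sets M" using BadM by auto
    have "prob A0 \<le> prob ((A0 - (\<Union>k. Bad k)) \<union> (\<Union>k. Bad k))"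
      using A0M BM by (intro finite_measure_mono) auto
    also have "\<dots> \<le> prob (A0 - (\<Union>k. Bad k)) + prob (\<Union>k. Bad k)"
      using A0M BM by (intro measure_Un_le) auto
    finally show ?thesis by simp
  qed
  also have "\<dots> \<le> prob {\<omega> \<in> space M. infinite (component (E \<omega>) 0)}"
  proof (rule finite_measure_mono[OF _ infinite_component_measurable], rule subsetI)
    fix \<omega> assume w: "\<omega> \<in> A0 - (\<Union>k. Bad k)"
    then have sp: "\<omega> \<in> space M" and h0: "h 0 < W 0 \<omega>" by (auto simp: A0_def)
    define G where "G k = {x \<in> V k. h k < W x \<omega>}" for k
    have "infinite (component (E \<omega>) 0)"
    proof (rule infinite_component_of_layers[of G])
      show "G 0 = {0}" using h0 by (auto simp: G_def root)
      show "G k \<noteq> {}" for k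
      proof (cases k)
        case 0
        then show ?thesis using h0 by (auto simp: G_def root)
      next
        case (Suc j)
        have "\<omega> \<notin> L j" using w by (auto simp: Bad_def)
        then show ?thesis using sp h0 by (force simp: L_def G_def Suc)
      qed
      show "(x, y) \<in> E \<omega>" if "x \<in> G k" "y \<in> G (Suc k)" "x \<noteq> y" for k x y
      proof (rule ccontr)
        assume "(x, y) \<notin> E \<omega>"
        then have "\<omega> \<in> U k x y" "(x, y) \<in> P k"
          using that sp h0 by (auto simp: U_def H_def P_def G_def)
        then have "\<omega> \<in> Bad k" by (auto simp: Bad_def)
        then show False using w by blast
      qed
      show "finite {k. x \<in> G k}" for x
        by (rule finite_subset[OF _ escape[of x]]) (auto simp: G_def)
    qed
    then show "\<omega> \<in> {\<omega> \<in> space M. infinite (component (E \<omega>) 0)}" using sp by simp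
  qed
  finally show ?thesis by (simp add: percolation_prob_def)
qed

end

section \<open>Cubes and summability\<close>

text \<open>
  The cube has side \<open>n\<close> and is at distance of order \<open>n\<close> from the origin, so consecutive cubes are
  at distance \<open>O(n)\<close>, and each vertex lies in only finitely many cubes.
\<close>

definition cube :: "nat \<Rightarrow> (int ^ 'd::finite) set" where
  "cube n = {x. \<forall>i. int n \<le> x $ i \<and> x $ i < 2 * int n}"

lemma
  shows finite_cube: "finite (cube n :: (int ^ 'd::finite) set)"
    and card_cube: "card (cube n :: (int ^ 'd::finite) set) = n ^ CARD('d)"
proof -
  let ?F = "\<Pi>\<^sub>E i\<in>(UNIV :: 'd set). {int n..<2 * int n}"
  have "bij_betw vec_lambda ?F (cube n :: (int ^ 'd) set)"
    by (rule bij_betwI[where g = vec_nth]) (auto simp: cube_def PiE_iff)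
  moreover have "finite ?F" by (rule finite_PiE) auto
  moreover have "card ?F = n ^ CARD('d)" by (simp add: card_PiE)
  ultimately show "finite (cube n :: (int ^ 'd) set)"
    "card (cube n :: (int ^ 'd) set) = n ^ CARD('d)"
    by (simp_all add: bij_betw_finite bij_betw_same_card[symmetric])
qed

lemma lattice_dist_le:
  fixes x y :: "int ^ 'd::finite"
  assumes "\<And>i. \<bar>x $ i - y $ i\<bar> \<le> b"
  shows "lattice_dist x y \<le> real CARD('d) * real_of_int b"
proof -
  have "lattice_dist x y \<le> (\<Sum>i\<in>(UNIV :: 'd set). \<bar>real_of_int (x $ i - y $ i)\<bar>)"
    unfolding lattice_dist_def using norm_le_l1_cart[of "\<chi> i. real_of_int (x $ i - y $ i)"] by simp
  also have "\<dots> \<le> (\<Sum>i\<in>(UNIV :: 'd set). real_of_int b)"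
    by (rule sum_mono) (use assms in \<open>metis of_int_abs of_int_le_iff\<close>)
  finally show ?thesis by simp
qed

lemma lattice_dist_pos: "x \<noteq> y \<Longrightarrow> 0 < lattice_dist x y"
  by (auto simp: lattice_dist_def vec_eq_iff)

lemma edge_prob_ge:
  assumes "0 < lam" "x \<noteq> y" "lattice_dist x y \<le> D" "0 \<le> \<alpha>" "0 \<le> s" "0 \<le> t" "s \<le> w x" "t \<le> w y"
  shows "1 - exp (- (lam * s * t / D powr \<alpha>)) \<le> edge_prob \<alpha> lam w x y"
proof -
  have pos: "0 < lattice_dist x y" using assms lattice_dist_pos by blast
  have "lam * s * t \<le> lam * w x * w y"
    using assms by (intro mult_mono) auto
  moreover have "lattice_dist x y powr \<alpha> \<le> D powr \<alpha>"
    using assms pos by (intro powr_mono2) auto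
  moreover have "0 \<le> lam * w x * w y" using assms by (intro mult_nonneg_nonneg) auto
  ultimately have "lam * s * t / D powr \<alpha> \<le> lam * w x * w y / lattice_dist x y powr \<alpha>"
    using pos by (intro frac_le) auto
  then show ?thesis by (simp add: edge_prob_def)
qed

lemma summable_stretched_exp:
  fixes K \<delta> a :: real
  assumes "0 < K" "0 < \<delta>"
  shows "summable (\<lambda>n. real (Suc n) powr a * exp (- K * real n powr \<delta>))"
proof (rule summable_comparison_test_bigo)
  show "summable (\<lambda>n. norm (1 / real n ^ 2))"
    using inverse_power_summable[of 2, where 'a = real] by (simp add: inverse_eq_divide)
  show "(\<lambda>n. real (Suc n) powr a * exp (- K * real n powr \<delta>)) \<in> O(\<lambda>n. 1 / real n ^ 2)"
    using assms by real_asymp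
qed

section \<open>Percolation for heavy-tailed weights\<close>

text \<open>
  The layers are the origin followed by the cubes of sides \<open>m + 1, m + 2, \<dots>\<close>, with threshold
  \<open>(k + m) powr \<beta>\<close> in layer \<open>k\<close>. The exponents \<open>\<epsilon>\<close> and \<open>\<delta>\<close> measure the room between \<open>\<beta>\<close> and
  its two bounds: \<open>\<epsilon>\<close> governs how unlikely a cube without heavy vertices is, and \<open>\<delta>\<close> how
  unlikely a missing edge between heavy vertices is.
\<close>

lemma (in scale_free_percolation) percolation_prob_pos:
  assumes lam: "0 < lam" and \<alpha>: "0 < \<alpha>" and \<tau>: "1 < \<tau>" and c: "0 < c"
    and tail: "\<And>x. 1 \<le> x \<Longrightarrow> c * x powr (- (\<tau> - 1)) \<le> measure \<mu> {x<..}"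
    and gamma: "\<alpha> * (\<tau> - 1) < 2 * real CARD('d)"
  shows "0 < percolation_prob M E"
proof -
  define d where "d = real CARD('d)"
  have d: "0 < d" by (simp add: d_def)
  have "\<alpha> / 2 < d / (\<tau> - 1)" using gamma \<tau> by (simp add: d_def field_simps)
  then obtain \<beta> where \<beta>: "\<alpha> / 2 < \<beta>" "\<beta> < d / (\<tau> - 1)" using dense by blast
  define \<delta> where "\<delta> = 2 * \<beta> - \<alpha>"
  define \<epsilon> where "\<epsilon> = d - \<beta> * (\<tau> - 1)"
  define K where "K = lam / (4 * d) powr \<alpha>"
  have \<beta>0: "0 < \<beta>" using \<beta>(1) \<alpha> by simp
  have \<delta>: "0 < \<delta>" using \<beta>(1) by (simp add: \<delta>_def)
  have \<epsilon>: "0 < \<epsilon>" using \<beta>(2) \<tau> by (simp add: \<epsilon>_def field_simps)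
  have K: "0 < K" using lam d by (simp add: K_def)
  define f where "f n = exp (- c * real n powr \<epsilon>)" for n
  define g where "g n = exp (- K * real n powr \<delta>)" for n
  \<comment> \<open>\<open>f n\<close> bounds the probability that the cube of side \<open>n\<close> has no heavy vertex, \<open>g n\<close> that of a
    missing edge at scale \<open>n\<close>, and \<open>(n + 1) powr (2 d)\<close> the number of pairs of vertices involved.\<close>
  define F where "F n = f (Suc n) + real (Suc n) powr (2 * d) * g n" for n
  have "summable (\<lambda>n. f (Suc n))"
    using summable_stretched_exp[OF c \<epsilon>, of 0] by (subst summable_Suc_iff) (simp add: f_def[abs_def])
  then have F: "summable F"
    unfolding F_def[abs_def] g_def using summable_stretched_exp[OF K \<delta>] by (intro summable_add)
  \<comment> \<open>The initial scale \<open>m\<close> is chosen so large that the total relative failure is below one;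
    \<open>m \<ge> 1\<close> keeps all thresholds in the range of the tail bound.\<close>
  obtain N where N: "\<And>n. n \<ge> N \<Longrightarrow> norm (\<Sum>k. F (k + n)) < 1"
    using suminf_exist_split[OF zero_less_one F] by blast
  define m where "m = max 1 N"
  have m1: "1 \<le> m" and mF: "(\<Sum>k. F (k + m)) < 1" using N[of m] by (auto simp: m_def)
  define V :: "nat \<Rightarrow> (int ^ 'd) set" where "V k = (if k = 0 then {0} else cube (k + m))" for k
  define h where "h k = real (k + m) powr \<beta>" for k
  have h1: "1 \<le> h k" for k using m1 \<beta>0 by (auto simp: h_def intro!: ge_one_powr_ge_zero)
  have Vfin: "finite (V k)" for k by (simp add: V_def finite_cube)
  have Vcard: "real (card (V k)) \<le> real (k + m) powr d" for k
    using m1 d by (auto simp: V_def card_cube d_def powr_realpow intro!: ge_one_powr_ge_zero)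
  have Vrange: "0 \<le> x $ i \<and> x $ i < 2 * int (k + m)" if "x \<in> V k" for x i k
    using that m1 by (auto simp: V_def cube_def split: if_splits dest!: spec[of _ i])
  have terms: "f (Suc k + m) + real (card (V k) * card (V (Suc k))) * g (k + m) \<le> F (k + m)" for k
  proof -
    have "real (card (V k)) * real (card (V (Suc k)))
        \<le> real (Suc (k + m)) powr d * real (Suc (k + m)) powr d"
    proof (rule mult_mono)
      have "real (k + m) powr d \<le> real (Suc (k + m)) powr d" using d by (intro powr_mono2) auto
      then show "real (card (V k)) \<le> real (Suc (k + m)) powr d" using Vcard[of k] by linarith
      show "real (card (V (Suc k))) \<le> real (Suc (k + m)) powr d" using Vcard[of "Suc k"] by simp
    qed auto
    then have "real (card (V k) * card (V (Suc k))) \<le> real (Suc (k + m)) powr (2 * d)"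
      by (simp add: powr_add[symmetric])
    then have "real (card (V k) * card (V (Suc k))) * g (k + m)
        \<le> real (Suc (k + m)) powr (2 * d) * g (k + m)"
      by (rule mult_right_mono) (simp add: g_def)
    then show ?thesis by (simp add: F_def)
  qed
  have sF: "summable (\<lambda>k. F (k + m))" using F by (rule summable_ignore_initial_segment)
  have s: "summable (\<lambda>k. f (Suc k + m) + real (card (V k) * card (V (Suc k))) * g (k + m))"
    by (rule summable_comparison_test'[OF sF]) (use terms in \<open>simp add: f_def g_def\<close>)
  show ?thesis
  proof (rule percolation_through_layers[of V h "\<lambda>k. f (Suc k + m)" "\<lambda>k. g (k + m)"])
    show "finite (V k)" for k by (rule Vfin)
    show "V 0 = {0}" by (simp add: V_def)
    show "finite {k. x \<in> V k}" for x
    proof (rule finite_subset)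
      show "{k. x \<in> V k} \<subseteq> insert 0 {..nat (x $ undefined)}"
        by (auto simp: V_def cube_def split: if_splits dest!: spec[of _ undefined])
    qed simp
    show "0 < prob {\<omega> \<in> space M. h 0 < W 0 \<omega>}"
    proof -
      have "0 < c * h 0 powr (- (\<tau> - 1))" using c h1[of 0] by simp
      also have "\<dots> \<le> measure \<mu> {h 0<..}" by (rule tail[OF h1])
      finally show ?thesis using prob_weight[of "{h 0<..}" 0] by simp
    qed
    show "prob {\<omega> \<in> space M. h 0 < W 0 \<omega> \<and> (\<forall>x\<in>V (Suc k). W x \<omega> \<le> h (Suc k))}
      \<le> f (Suc k + m) * prob {\<omega> \<in> space M. h 0 < W 0 \<omega>}" for k
    proof -
      let ?n = "real (Suc k + m)"
      have "measure \<mu> {..h (Suc k)} = 1 - measure \<mu> {h (Suc k)<..}"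
        by (rule measure_weight_atMost)
      also have "\<dots> \<le> 1 - c * ?n powr (- (\<beta> * (\<tau> - 1)))"
        using tail[OF h1[of "Suc k"]] by (simp add: h_def powr_powr algebra_simps)
      also have "\<dots> \<le> exp (- (c * ?n powr (- (\<beta> * (\<tau> - 1)))))"
        using exp_ge_add_one_self[of "- (c * ?n powr (- (\<beta> * (\<tau> - 1))))"] by simp
      finally have "measure \<mu> {..h (Suc k)} ^ card (V (Suc k))
          \<le> exp (- (c * ?n powr (- (\<beta> * (\<tau> - 1))))) ^ card (V (Suc k))"
        by (intro power_mono) auto
      also have "\<dots> = exp (- (c * (?n powr (- (\<beta> * (\<tau> - 1))) * real (card (V (Suc k))))))"
        by (simp add: exp_of_nat_mult[symmetric] algebra_simps)
      also have "real (card (V (Suc k))) = ?n powr d"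
        by (simp add: V_def card_cube d_def powr_realpow)
      also have "?n powr (- (\<beta> * (\<tau> - 1))) * ?n powr d = ?n powr \<epsilon>"
        by (simp add: powr_add[symmetric] \<epsilon>_def)
      finally have "measure \<mu> {..h (Suc k)} ^ card (V (Suc k)) \<le> f (Suc k + m)"
        by (simp add: f_def)
      moreover have "0 \<notin> V (Suc k)" using m1 by (auto simp: V_def cube_def)
      ultimately show ?thesis
        by (subst prob_heavy_light[OF Vfin]) (auto simp: mult.commute[of "prob _"] intro!: mult_right_mono)
    qed
    show "1 - g (k + m) \<le> edge_prob \<alpha> lam w x y"
      if xy: "x \<in> V k" "y \<in> V (Suc k)" "x \<noteq> y" and w: "h k < w x" "h (Suc k) < w y" for k x y w
    proof -
      let ?n = "real (k + m)"
      \<comment> \<open>All coordinates lie in \<open>{0..<2 * (k + m + 1)}\<close>, and \<open>2 (n + 1) \<le> 4 n\<close> for \<open>n \<ge> 1\<close>.\<close>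
      have "\<bar>x $ i - y $ i\<bar> \<le> 4 * int (k + m)" for i
        using Vrange[OF xy(1), of i] Vrange[OF xy(2), of i] m1 by auto
      then have D: "lattice_dist x y \<le> 4 * d * ?n"
        using lattice_dist_le[of x y "4 * int (k + m)"] by (simp add: d_def algebra_simps)
      \<comment> \<open>Both weights are bounded below by the smaller threshold \<open>h k\<close>.\<close>
      have "h k \<le> h (Suc k)" unfolding h_def using \<beta>0 by (intro powr_mono2) auto
      then have "1 - exp (- (lam * h k * h k / (4 * d * ?n) powr \<alpha>)) \<le> edge_prob \<alpha> lam w x y"
        using w h1[of k] lam \<alpha> xy(3) D by (intro edge_prob_ge) auto
      moreover have "lam * h k * h k / (4 * d * ?n) powr \<alpha> = K * ?n powr \<delta>"
      proof -
        have "?n powr \<delta> = ?n powr \<beta> * ?n powr \<beta> / ?n powr \<alpha>"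
          by (simp add: \<delta>_def powr_diff powr_add[symmetric])
        then show ?thesis using d by (simp add: h_def K_def powr_mult)
      qed
      ultimately show ?thesis by (simp add: g_def)
    qed
    show "0 \<le> g (k + m)" for k by (simp add: g_def)
    show "summable (\<lambda>k. f (Suc k + m) + real (card (V k) * card (V (Suc k))) * g (k + m))"
      by (rule s)
    show "(\<Sum>k. f (Suc k + m) + real (card (V k) * card (V (Suc k))) * g (k + m)) < 1"
      using suminf_le[OF terms s sF] mF by linarith
  qed
qed

theorem theorem4p4:
  fixes M :: "real \<Rightarrow> 'w measure"
    and W :: "real \<Rightarrow> int ^ 'd::finite \<Rightarrow> 'w \<Rightarrow> real"
    and E :: "real \<Rightarrow> 'w \<Rightarrow> ((int ^ 'd) \<times> (int ^ 'd)) set"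
    and \<mu> :: "real measure"
    and \<alpha> \<tau> c :: real
  assumes "real CARD('d) < \<alpha>"
    and "\<And>lam. 0 < lam \<Longrightarrow> scale_free_percolation (M lam) \<mu> \<alpha> lam (W lam) (E lam)"
    and "AE w in \<mu>. 0 \<le> w"
    and "integrable \<mu> (\<lambda>w. w) \<Longrightarrow> (\<integral>w. w \<partial>\<mu>) = 1"
    and "1 < \<tau>" and "0 < c"
    and "\<And>x. 1 \<le> x \<Longrightarrow> c * x powr (- (\<tau> - 1)) \<le> measure \<mu> {x<..}"
    and "\<alpha> * (\<tau> - 1) / real CARD('d) < 2"
  shows "(\<forall>lam>0. 0 < percolation_prob (M lam) (E lam)) \<and>
    critical_value (\<lambda>lam. percolation_prob (M lam) (E lam)) = 0"
proof -
  have pos: "0 < percolation_prob (M lam) (E lam)" if "0 < lam" for lam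
  proof (rule scale_free_percolation.percolation_prob_pos)
    show "scale_free_percolation (M lam) \<mu> \<alpha> lam (W lam) (E lam)" using assms(2) that .
    show "\<And>x. 1 \<le> x \<Longrightarrow> c * x powr (- (\<tau> - 1)) \<le> measure \<mu> {x<..}" by (rule assms(7))
    show "0 < \<alpha>" using assms(1) of_nat_0_le_iff[of "CARD('d)"] by linarith
    show "\<alpha> * (\<tau> - 1) < 2 * real CARD('d)" using assms(8) by (simp add: field_simps)
  qed (use that assms(5,6) in auto)
  then have "{lam. 0 < lam \<and> 0 < percolation_prob (M lam) (E lam)} = {0<..}" by auto
  moreover have "Inf (ereal ` {0<..}) = 0"
  proof (rule antisym)
    show "Inf (ereal ` {0<..}) \<le> 0"
    proof (rule dense_ge)
      fix y :: ereal assume "0 < y"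
      then obtain r where "0 < ereal r" "ereal r < y" using ereal_dense2 by blast
      then show "Inf (ereal ` {0<..}) \<le> y" by (intro Inf_lower2[of "ereal r"]) auto
    qed
    show "0 \<le> Inf (ereal ` {0<..})" by (rule Inf_greatest) auto
  qed
  ultimately show ?thesis using pos by (simp add: critical_value_def)
qed

end
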